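(* Let $C>0$ be a constant. Builder has a $\left(\tau_1, (1/2 + C^{-1/2}/2)n\right)$-strategy that with probability at least $(1-o(1))\frac{\sqrt{C}}{e^{C}}$ yields a graph with minimum degree at least $1$.
   Context: Let $V=[n]$, $N=\binom{n}{2}$, and let $e_1,\dots,e_N$ be a uniformly random permutation of the edges of the complete graph $K_n$ on $V$; $\mathbf{G}_{n,m}$ denotes the graph on $V$ with edge set $\{e_1,\dots,e_m\}$ (the random graph process). A player, Builder, sees the edges $e_1,e_2,\dots$ one by one and must decide irrevocably upon seeing $e_i$ whether to purchase it; her graph $B_i$ consists of the edges purchased among $e_1,\dots,e_i$. A $(t,b)$-strategy is an online algorithm (deterministic or randomised) that Builder follows in this model where she sees only the first $t$ edges of the permutation and purchases at most $b$ of them; the strategy yields the graph $B_t$. Here $\tau_1=\min\{m: \delta(\mathbf{G}_{n,m})\ge 1\}$ is the hitting time for having no isolated vertices. The $o(1)$ term tends to $0$ as $n\to\infty$. *)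

theory Defs
  imports "HOL-Probability.Probability_Mass_Function" "HOL-Combinatorics.Multiset_Permutations"
begin

type_synonym edge = "nat set"

definition complete_edges :: "nat \<Rightarrow> edge set" where
  "complete_edges n = {e. e \<subseteq> {1..n} \<and> card e = 2}"

text \<open>Graphs on the vertex set \<open>{1..n}\<close> are given by their edge sets.\<close>

definition degree :: "edge set \<Rightarrow> nat \<Rightarrow> nat" where
  "degree E v = card {e \<in> E. v \<in> e}"

text \<open>For \<open>n = 0\<close> the minimum ranges over the empty set and is unspecified.\<close>

definition min_degree :: "nat \<Rightarrow> edge set \<Rightarrow> nat" where
  "min_degree n E = Min (degree E ` {1..n})"

text \<open>An ordering \<open>e\<^sub>1, \<dots>, e\<^sub>N\<close> of the edges of the complete graph is a
  distinct list \<open>es\<close>; the random graph process takes it uniformly at random.\<close>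

definition edge_process :: "nat \<Rightarrow> edge list pmf" where
  "edge_process n = pmf_of_set (permutations_of_set (complete_edges n))"

definition process_graph :: "edge list \<Rightarrow> nat \<Rightarrow> edge set" where
  "process_graph es m = set (take m es)"

text \<open>The hitting time of minimum degree at least \<open>k\<close>. It is unspecified if the complete
  graph itself has smaller minimum degree; for \<open>k = 1\<close> this does not happen if \<open>n \<ge> 2\<close>.\<close>

definition tau :: "nat \<Rightarrow> nat \<Rightarrow> edge list \<Rightarrow> nat" where
  "tau k n es = (LEAST m. min_degree n (process_graph es m) \<ge> k)"

text \<open>A history lists the edges seen so far, in order, each with the decision taken
  (\<open>True\<close> meaning purchased). A randomised online algorithm chooses, given the history and
  the current edge, a distribution on the two possible decisions; it is deterministic if
  all these distributions are point masses.\<close>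

type_synonym history = "(edge \<times> bool) list"
type_synonym strategy = "history \<Rightarrow> edge \<Rightarrow> bool pmf"

primrec run :: "strategy \<Rightarrow> history \<Rightarrow> edge list \<Rightarrow> history pmf" where
  "run S h [] = return_pmf h"
| "run S h (e # es) = bind_pmf (S h e) (\<lambda>d. run S (h @ [(e, d)]) es)"

definition purchased :: "history \<Rightarrow> edge set" where
  "purchased h = {e. (e, True) \<in> set h}"

text \<open>The distribution of \<open>B\<^sub>t\<close>, over both the edge ordering and the randomness of the
  strategy. The time \<open>t\<close> may depend on the ordering, as a hitting time does; the strategy
  is not given \<open>t\<close>, but only the edges up to that time, one by one.\<close>

definition builder_graph :: "nat \<Rightarrow> (edge list \<Rightarrow> nat) \<Rightarrow> strategy \<Rightarrow> edge set pmf" where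
  "builder_graph n t S =
     bind_pmf (edge_process n) (\<lambda>es. map_pmf purchased (run S [] (take (t es) es)))"

text \<open>The budget must be respected in every outcome. The bound \<open>b\<close> need not be an integer.\<close>

definition is_strategy :: "nat \<Rightarrow> (edge list \<Rightarrow> nat) \<Rightarrow> real \<Rightarrow> strategy \<Rightarrow> bool" where
  "is_strategy n t b S \<longleftrightarrow> (\<forall>B \<in> set_pmf (builder_graph n t S). real (card B) \<le> b)"

end

theory Submission
  imports Defs "HOL-Probability.Random_Permutations" "HOL-Real_Asymp.Real_Asymp"
begin

text \<open>
  Put \<open>s = sqrt C\<close>. While more than \<open>n / s\<close> vertices are uncovered, Builder buys an edge iff both
  its ends are uncovered; afterwards she buys every edge that covers a new vertex. The budget
  \<open>(n + n / s) / 2\<close> then holds in every outcome. If \<open>s \<le> 1\<close>, she never skips a useful edge. Let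
  \<open>s > 1\<close>. In the first phase every pair of uncovered vertices is still to come, so each edge is
  bought with probability about \<open>1 / s\<^sup>2\<close> at least, and an exponential moment shows that with high
  probability the phase ends by time \<open>T = \<alpha> n / 2\<close>, for any \<open>\<alpha> > s\<^sup>2 - s\<close>. Builder then succeeds
  if every vertex has an edge between \<open>T\<close> and the hitting time, which is the case if the last vertex
  covered by the edges after time \<open>T\<close> had been isolated at time \<open>T\<close>. This has probability about
  \<open>exp (- \<alpha>)\<close>; a union bound over finitely many time levels gives \<open>55 / 144 * exp (- \<alpha>)\<close>, and this
  is enough, since \<open>s * exp (- s) \<le> exp (- 1) < 55 / 144\<close>.
\<close>

section \<open>The strategy\<close>

definition buys :: "real \<Rightarrow> nat set \<Rightarrow> edge \<Rightarrow> bool" where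
  "buys \<theta> U e \<longleftrightarrow> (if \<theta> < real (card U) then e \<subseteq> U else e \<inter> U \<noteq> {})"

definition cover_strategy :: "real \<Rightarrow> nat \<Rightarrow> strategy" where
  "cover_strategy \<theta> n h e = return_pmf (buys \<theta> ({1..n} - \<Union>(purchased h)) e)"

text \<open>The set \<open>U\<close> of uncovered vertices is carried as a state that inductions
  over the edge list may vary. \<open>run_cover_strategy\<close> identifies this recursion with the
  strategy, which recomputes \<open>U\<close> from the history.\<close>

primrec decisions :: "real \<Rightarrow> nat set \<Rightarrow> edge list \<Rightarrow> history" where
  "decisions \<theta> U [] = []"
| "decisions \<theta> U (e # es) =
     (e, buys \<theta> U e) # decisions \<theta> (if buys \<theta> U e then U - e else U) es"

primrec uncovered :: "real \<Rightarrow> nat set \<Rightarrow> edge list \<Rightarrow> nat set" where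
  "uncovered \<theta> U [] = U"
| "uncovered \<theta> U (e # es) = uncovered \<theta> (if buys \<theta> U e then U - e else U) es"

lemma purchased_Nil [simp]: "purchased [] = {}"
  by (simp add: purchased_def)

lemma purchased_Cons [simp]:
  "purchased ((e, d) # h) = (if d then insert e (purchased h) else purchased h)"
  by (auto simp: purchased_def)

lemma purchased_append [simp]: "purchased (h @ h') = purchased h \<union> purchased h'"
  by (auto simp: purchased_def)

lemma run_cover_strategy:
  "run (cover_strategy \<theta> n) h es =
     return_pmf (h @ decisions \<theta> ({1..n} - \<Union>(purchased h)) es)"
proof (induction es arbitrary: h)
  case (Cons e es)
  let ?U = "{1..n} - \<Union>(purchased h)"
  have "{1..n} - \<Union>(purchased (h @ [(e, buys \<theta> ?U e)])) =
      (if buys \<theta> ?U e then ?U - e else ?U)"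
    by auto
  then show ?case
    unfolding run.simps decisions.simps cover_strategy_def bind_return_pmf
    by (simp only: Cons.IH[unfolded cover_strategy_def] append_assoc append_Cons append_Nil)
qed simp

lemma uncovered_eq: "uncovered \<theta> U es = U - \<Union>(purchased (decisions \<theta> U es))"
  by (induction es arbitrary: U) auto

lemma uncovered_append: "uncovered \<theta> U (xs @ ys) = uncovered \<theta> (uncovered \<theta> U xs) ys"
  by (induction xs arbitrary: U) auto

lemma finite_purchased [simp]: "finite (purchased h)"
proof -
  have "purchased h \<subseteq> fst ` set h"
    by (force simp: purchased_def)
  then show ?thesis
    by (rule finite_subset) simp
qed

text \<open>The right-hand side is a potential that drops by at least one with each purchase: above
  the threshold two vertices leave \<open>U\<close>, and from the threshold downwards both summands
  lose at least one.\<close>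

lemma card_purchased_decisions_le:
  fixes \<theta> :: real
  assumes "finite U" "\<theta> \<ge> 0" "\<And>e. e \<in> set es \<Longrightarrow> card e = 2"
  shows "real (card (purchased (decisions \<theta> U es))) \<le> (card U + min (card U) \<theta>) / 2"
  using assms
proof (induction es arbitrary: U)
  case (Cons e es)
  show ?case
  proof (cases "buys \<theta> U e")
    case False
    with Cons show ?thesis by auto
  next
    case True
    let ?P = "purchased (decisions \<theta> (U - e) es)"
    have *: "real (card ?P) \<le> (card (U - e) + min (card (U - e)) \<theta>) / 2"
      using Cons.IH[of "U - e"] Cons.prems by auto
    have "finite e"
      using Cons.prems(3)[of e] by (auto intro: card_ge_0_finite)
    have "card (insert e ?P) \<le> Suc (card ?P)"
      by (simp add: card_insert_if)
    moreover have "real (card ?P) + 1 \<le> (card U + min (card U) \<theta>) / 2"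
    proof (cases "\<theta> < real (card U)")
      case 1: True
      then have "e \<subseteq> U"
        using True by (simp add: buys_def)
      then have "card (U - e) = card U - 2" "2 \<le> card U"
        using Cons.prems(1,3) \<open>finite e\<close> card_mono[of U e] by (auto simp: card_Diff_subset)
      then show ?thesis
        using * 1 by auto
    next
      case 2: False
      then have "e \<inter> U \<noteq> {}"
        using True by (simp add: buys_def)
      then have "U - e \<subset> U"
        by auto
      then have "card (U - e) < card U"
        using Cons.prems(1) by (rule psubset_card_mono[rotated])
      then show ?thesis
        using * 2 by auto
    qed
    ultimately show ?thesis
      using True by simp
  qed
qed auto

text \<open>Once the threshold is reached, an edge is skipped only if it misses \<open>U\<close>. So
  each edge, bought or not, turns \<open>U\<close> into \<open>U - e\<close>, and the threshold is
  never exceeded again.\<close>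

lemma uncovered_late:
  assumes "finite U" "real (card U) \<le> \<theta>"
  shows "uncovered \<theta> U es = U - \<Union>(set es)"
  using assms
proof (induction es arbitrary: U)
  case (Cons e es)
  have "(if buys \<theta> U e then U - e else U) = U - e"
    using Cons.prems by (auto simp: buys_def)
  moreover have "real (card (U - e)) \<le> \<theta>"
    using Cons.prems card_mono[of U "U - e"] by force
  ultimately show ?case
    using Cons.IH[of "U - e"] Cons.prems by auto
qed simp

section \<open>Minimum degree and covered vertices\<close>

lemma min_degree_ge_1_iff:
  assumes "n \<ge> 1" "finite B"
  shows "min_degree n B \<ge> 1 \<longleftrightarrow> {1..n} \<subseteq> \<Union>B"
proof -
  have "degree B v \<ge> 1 \<longleftrightarrow> v \<in> \<Union>B" for v
  proof -
    have "degree B v \<ge> 1 \<longleftrightarrow> {e \<in> B. v \<in> e} \<noteq> {}"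
      using assms by (simp add: degree_def Suc_le_eq card_gt_0_iff)
    then show ?thesis by blast
  qed
  then show ?thesis
    using assms by (auto simp: min_degree_def)
qed

lemma finite_complete_edges [simp]: "finite (complete_edges n)"
  by (rule finite_subset[of _ "Pow {1..n}"]) (auto simp: complete_edges_def)

lemma card_complete_edges: "card (complete_edges n) = n choose 2"
  using n_subsets[of "{1..n}" 2] by (simp add: complete_edges_def)

lemma complete_edges_pair:
  "u \<in> {1..n} \<Longrightarrow> v \<in> {1..n} \<Longrightarrow> u \<noteq> v \<Longrightarrow> {u, v} \<in> complete_edges n"
  by (auto simp: complete_edges_def)

lemma Union_complete_edges:
  assumes "n \<ge> 2"
  shows "{1..n} \<subseteq> \<Union>(complete_edges n)"
proof
  fix v assume v: "v \<in> {1..n}"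
  have "(if v = 1 then 2 else 1) \<in> {1..n}" "(if v = 1 then 2 else 1) \<noteq> v"
    using assms by auto
  with v show "v \<in> \<Union>(complete_edges n)"
    using complete_edges_pair[of v n "if v = 1 then 2 else 1"] by (metis UnionI insertI1)
qed

definition orderings :: "nat \<Rightarrow> edge list set" where
  "orderings n = permutations_of_set (complete_edges n)"

lemma set_pmf_edge_process: "set_pmf (edge_process n) = orderings n"
  by (simp add: edge_process_def orderings_def)

lemma cover_at_tau:
  assumes "n \<ge> 2" "es \<in> orderings n"
  shows "{1..n} \<subseteq> \<Union>(set (take (tau 1 n es) es))"
proof -
  have "set es = complete_edges n"
    using assms by (simp add: orderings_def permutations_of_set_def)
  \<comment> \<open>The whole ordering yields the complete graph, so the minimum in
    \<open>tau\<close> ranges over a nonempty set and is attained.\<close>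
  then have "min_degree n (process_graph es (length es)) \<ge> 1"
    using assms(1) Union_complete_edges[OF assms(1)]
    by (subst min_degree_ge_1_iff) (simp_all add: process_graph_def)
  then have "min_degree n (process_graph es (tau 1 n es)) \<ge> 1"
    unfolding tau_def by (rule LeastI)
  then show ?thesis
    using assms(1) by (subst (asm) min_degree_ge_1_iff) (simp_all add: process_graph_def)
qed

lemma builder_graph_cover_strategy:
  "builder_graph n t (cover_strategy \<theta> n) =
     map_pmf (\<lambda>es. purchased (decisions \<theta> {1..n} (take (t es) es))) (edge_process n)"
  by (simp add: builder_graph_def run_cover_strategy map_pmf_def bind_return_pmf)

lemma is_strategy_cover_strategy:
  assumes "\<theta> \<ge> 0"
  shows "is_strategy n t ((real n + \<theta>) / 2) (cover_strategy \<theta> n)"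
  unfolding is_strategy_def
proof
  fix B assume "B \<in> set_pmf (builder_graph n t (cover_strategy \<theta> n))"
  then obtain es where es: "es \<in> orderings n"
      and B: "B = purchased (decisions \<theta> {1..n} (take (t es) es))"
    by (auto simp: builder_graph_cover_strategy set_pmf_edge_process)
  have "card e = 2" if "e \<in> set (take (t es) es)" for e
    using that es set_take_subset[of "t es" es]
    by (auto simp: orderings_def permutations_of_set_def complete_edges_def)
  then have "real (card B) \<le> (real (card {1..n}) + min (real (card {1..n})) \<theta>) / 2"
    unfolding B using assms by (intro card_purchased_decisions_le) auto
  then show "real (card B) \<le> (real n + \<theta>) / 2"
    by simp
qed

section \<open>A sufficient event for success\<close>

definition last_isolated :: "nat \<Rightarrow> nat \<Rightarrow> edge list \<Rightarrow> bool" where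
  "last_isolated n T es \<longleftrightarrow> (\<exists>v\<in>{1..n}. \<exists>m. v \<notin> \<Union>(set (take (T + m) es)) \<and>
     {1..n} - {v} \<subseteq> \<Union>(set (take m (drop T es))))"

text \<open>The isolated vertex \<open>v\<close> delays the hitting time beyond
  \<open>T + m\<close>. Hence the block of \<open>m\<close> edges after \<open>T\<close>, which
  covers all other vertices, comes before the hitting time, and so does the first edge at
  \<open>v\<close>, which itself comes after \<open>T\<close>.\<close>

lemma cover_after_if_last_isolated:
  assumes "n \<ge> 2" "es \<in> orderings n" "last_isolated n T es"
  shows "T \<le> tau 1 n es" "{1..n} \<subseteq> \<Union>(set (drop T (take (tau 1 n es) es)))"
proof -
  let ?t = "tau 1 n es"
  obtain v m where v: "v \<in> {1..n}" "v \<notin> \<Union>(set (take (T + m) es))"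
      "{1..n} - {v} \<subseteq> \<Union>(set (take m (drop T es)))"
    using assms(3) by (auto simp: last_isolated_def)
  have cov: "v \<in> \<Union>(set (take ?t es))"
    using cover_at_tau[OF assms(1,2)] v(1) by blast
  have t: "T + m < ?t"
  proof (rule ccontr)
    assume "\<not> T + m < ?t"
    then have "set (take ?t es) \<subseteq> set (take (T + m) es)"
      by (intro set_take_subset_set_take) simp
    with cov v(2) show False by blast
  qed
  then show "T \<le> ?t" by simp
  have "set (take ?t es) = set (take T es) \<union> set (drop T (take ?t es))"
    using t by (metis append_take_drop_id less_or_eq_imp_le add_leD1 set_append take_take min.absorb1)
  moreover have "set (take T es) \<subseteq> set (take (T + m) es)"
    by (intro set_take_subset_set_take) simp
  ultimately have "v \<in> \<Union>(set (drop T (take ?t es)))"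
    using cov v(2) by blast
  moreover have "set (take m (drop T es)) \<subseteq> set (drop T (take ?t es))"
    unfolding drop_take using t by (intro set_take_subset_set_take) simp
  then have "{1..n} - {v} \<subseteq> \<Union>(set (drop T (take ?t es)))"
    using v(3) by blast
  ultimately show "{1..n} \<subseteq> \<Union>(set (drop T (take ?t es)))"
    by blast
qed

text \<open>If the first phase is over at time \<open>T\<close>, then by
  \<open>uncovered_late\<close> Builder covers every vertex that the edges between \<open>T\<close>
  and the hitting time cover.\<close>

lemma success_if:
  assumes "n \<ge> 2" "es \<in> orderings n" "T \<le> tau 1 n es"
    "{1..n} \<subseteq> \<Union>(set (drop T (take (tau 1 n es) es)))"
    "real (card (uncovered \<theta> {1..n} (take T es))) \<le> \<theta>"
  shows "min_degree n (purchased (decisions \<theta> {1..n} (take (tau 1 n es) es))) \<ge> 1"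
proof -
  let ?t = "tau 1 n es"
  let ?U = "uncovered \<theta> {1..n} (take T es)"
  have split: "take ?t es = take T es @ drop T (take ?t es)"
    using assms(3) by (metis append_take_drop_id take_take min.absorb1)
  have "?U \<subseteq> {1..n}"
    by (auto simp: uncovered_eq)
  then have "finite ?U"
    by (rule finite_subset) simp
  have "uncovered \<theta> {1..n} (take ?t es) = ?U - \<Union>(set (drop T (take ?t es)))"
    by (subst split, subst uncovered_append)
       (rule uncovered_late[OF \<open>finite ?U\<close> assms(5)])
  also have "\<dots> = {}"
    using \<open>?U \<subseteq> {1..n}\<close> assms(4) by blast
  finally show ?thesis
    using assms(1) by (subst min_degree_ge_1_iff) (simp_all add: uncovered_eq)
qed

text \<open>The time \<open>T\<close> is free. Each probability on the right depends on the ordering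
  only and is estimated separately; a union bound combines them.\<close>

lemma prob_success_ge:
  assumes "n \<ge> 2"
  shows "measure_pmf.prob (builder_graph n (tau 1 n) (cover_strategy \<theta> n)) {B. min_degree n B \<ge> 1}
    \<ge> measure_pmf.prob (edge_process n) {es. last_isolated n T es}
      - measure_pmf.prob (edge_process n) {es. \<theta> < real (card (uncovered \<theta> {1..n} (take T es)))}"
proof -
  let ?P = "measure_pmf.prob (edge_process n)"
  let ?G = "{es. min_degree n (purchased (decisions \<theta> {1..n} (take (tau 1 n es) es))) \<ge> 1}"
  let ?L = "{es. last_isolated n T es}"
  let ?F = "{es. \<theta> < real (card (uncovered \<theta> {1..n} (take T es)))}"
  have "?P ?L = ?P (?L \<inter> set_pmf (edge_process n))"
    by (simp add: measure_Int_set_pmf)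
  also have "\<dots> \<le> ?P (?G \<union> ?F)"
  proof (rule measure_pmf.finite_measure_mono)
    show "?L \<inter> set_pmf (edge_process n) \<subseteq> ?G \<union> ?F"
      using cover_after_if_last_isolated[OF assms] success_if[OF assms]
      by (fastforce simp: set_pmf_edge_process not_less)
  qed simp
  also have "\<dots> \<le> ?P ?G + ?P ?F"
    by (rule measure_subadditive) auto
  finally show ?thesis
    by (simp add: builder_graph_cover_strategy vimage_def)
qed

text \<open>Here the second phase starts at once, so \<open>success_if\<close> applies with
  \<open>T = 0\<close>.\<close>

lemma prob_success_large_threshold:
  assumes "n \<ge> 2" "\<theta> \<ge> real n"
  shows "measure_pmf.prob (builder_graph n (tau 1 n) (cover_strategy \<theta> n)) {B. min_degree n B \<ge> 1} = 1"
proof -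
  have "min_degree n (purchased (decisions \<theta> {1..n} (take (tau 1 n es) es))) \<ge> 1"
    if "es \<in> orderings n" for es
    using success_if[OF assms(1) that, of 0 \<theta>] cover_at_tau[OF assms(1) that] assms(2) by simp
  then show ?thesis
    by (subst measure_pmf.prob_eq_1)
       (auto simp: builder_graph_cover_strategy AE_measure_pmf_iff set_pmf_edge_process)
qed

section \<open>Uniform random permutations\<close>

text \<open>Conditioning on the first element leaves a uniform ordering of the other ones. This
  recursion drives the inductions below.\<close>

lemma prob_permutation_Cons:
  assumes "finite A" "A \<noteq> {}"
  shows "measure_pmf.prob (pmf_of_set (permutations_of_set A)) {xs. Q xs} =
    (\<Sum>x\<in>A. measure_pmf.prob (pmf_of_set (permutations_of_set (A - {x}))) {xs. Q (x # xs)}) / card A"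
proof -
  have *: "measure_pmf.prob p {x. R x} = pmf (map_pmf R p) True" for p :: "'b pmf" and R
    by (simp add: pmf_map vimage_def)
  show ?thesis
    unfolding * random_permutation_of_set[OF assms] map_bind_pmf pmf_bind_pmf_of_set[OF assms(2,1)]
    by (simp add: map_pmf_def bind_assoc_pmf bind_return_pmf)
qed

abbreviation permutation_prob :: "'a set \<Rightarrow> ('a list \<Rightarrow> bool) \<Rightarrow> real" where
  "permutation_prob A Q \<equiv> measure_pmf.prob (pmf_of_set (permutations_of_set A)) {xs. Q xs}"

section \<open>The length of the first phase\<close>

lemma real_choose_two: "real (n choose 2) = real n * (real n - 1) / 2"
  by (induction n) (simp_all add: numeral_2_eq_2 field_simps)

text \<open>The premise that all pairs in \<open>U\<close> are still to come is an invariant of the first phase: an edge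
  inside \<open>U\<close> that was seen would have been bought.\<close>

lemma prob_uncovered_gt_le:
  fixes \<theta> p z :: real
  assumes "finite U" "finite A" "\<And>e. e \<in> A \<Longrightarrow> card e = 2"
    and "{e. e \<subseteq> U \<and> card e = 2} \<subseteq> A"
    and "\<theta> \<ge> 1" "z > 1" "0 < p" "p \<le> 1" "p * card A \<le> \<theta> * (\<theta> - 1) / 2"
  shows "permutation_prob A (\<lambda>xs. \<theta> < card (uncovered \<theta> U (take t xs)))
    \<le> z powr ((card U - \<theta>) / 2) * (1 - p * (1 - 1 / z)) ^ t"
  using assms(1-4,9)
proof (induction t arbitrary: U A)
  case 0
  show ?case
  proof (cases "\<theta> < card U")
    case True
    then have "1 \<le> z powr ((card U - \<theta>) / 2)"
      using assms(6) by (intro ge_one_powr_ge_zero) auto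
    then show ?thesis
      using True by simp
  qed simp
next
  case (Suc t)
  let ?c = "card U" and ?E = "{e. e \<subseteq> U \<and> card e = 2}"
  let ?r = "1 - p * (1 - 1 / z)"
  have r0: "?r \<ge> 0"
  proof -
    have "p * (1 - 1 / z) \<le> 1 * 1"
      using assms(6-8) by (intro mult_mono) auto
    then show ?thesis by simp
  qed
  show ?case
  proof (cases "\<theta> < ?c")
    case False
    have "\<not> \<theta> < card (uncovered \<theta> U xs)" for xs
      using uncovered_late[OF Suc.prems(1), of \<theta> xs] False card_mono[of U "U - \<Union>(set xs)"] Suc.prems(1)
      by auto
    then show ?thesis
      using r0 by simp
  next
    case True
    have "card ?E = ?c choose 2"
      using n_subsets[OF Suc.prems(1)] by simp
    then have cE: "real (card ?E) = real ?c * (real ?c - 1) / 2"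
      by (simp add: real_choose_two)
    have "\<theta> * (\<theta> - 1) \<le> real ?c * (real ?c - 1)"
      using True assms(5) by (intro mult_mono) auto
    \<comment> \<open>In other words, the next edge lies inside \<open>U\<close> with probability at
      least \<open>p\<close>.\<close>
    then have pE: "p * card A \<le> card ?E"
      using Suc.prems(5) cE by simp
    have "real ?c * (real ?c - 1) > 0"
      using True assms(5) by (intro mult_pos_pos) auto
    then have "?E \<noteq> {}"
      using cE by (metis card.empty divide_eq_0_iff less_irrefl of_nat_0 zero_neq_numeral)
    then have "A \<noteq> {}"
      using Suc.prems(4) by blast
    then have cA: "real (card A) > 0"
      using Suc.prems(2) by (simp add: card_gt_0_iff)
    have EA: "?E \<subseteq> A" "finite ?E"
      using Suc.prems(2,4) finite_subset by blast+
    let ?b = "z powr ((?c - \<theta>) / 2) * ?r ^ t"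
    have b0: "?b \<ge> 0"
      using r0 by simp
    \<comment> \<open>A purchase removes two vertices from \<open>U\<close> and thus divides the
      bound by \<open>z\<close>; a skipped edge leaves it as it is. Averaging over \<open>e\<close>
      produces the factor \<open>?r\<close>.\<close>
    have step: "permutation_prob (A - {e}) (\<lambda>xs. \<theta> < card (uncovered \<theta> U (take (Suc t) (e # xs))))
        \<le> (if e \<in> ?E then ?b / z else ?b)" if e: "e \<in> A" for e
    proof -
      have "p * card (A - {e}) \<le> p * card A"
        using assms(7) card_mono[of A "A - {e}"] Suc.prems(2) by (intro mult_left_mono) auto
      then have pA: "p * card (A - {e}) \<le> \<theta> * (\<theta> - 1) / 2"
        using Suc.prems(5) by simp
      show ?thesis
      proof (cases "e \<subseteq> U")
        case 1: True
        \<comment> \<open>As \<open>e\<close> is nonempty, it is not a pair inside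
          \<open>U - e\<close>. So the pairs inside \<open>U - e\<close> are all still in
          \<open>A - {e}\<close>, and the invariant persists.\<close>
        have ne: "e \<noteq> {}" and ce: "card e = 2"
          using Suc.prems(3)[OF e] by auto
        have "card (U - e) = ?c - 2" "2 \<le> ?c"
          using 1 ce card_mono[of U e] Suc.prems(1) by (auto simp: card_Diff_subset finite_subset)
        then have "real (card (U - e)) = real ?c - 2" by simp
        then have pw: "z powr ((card (U - e) - \<theta>) / 2) = z powr ((?c - \<theta>) / 2) / z"
          using assms(6) by (simp add: diff_divide_distrib powr_diff)
        have "permutation_prob (A - {e}) (\<lambda>xs. \<theta> < card (uncovered \<theta> (U - e) (take t xs)))
          \<le> z powr ((card (U - e) - \<theta>) / 2) * ?r ^ t"
          using Suc.prems ne pA by (intro Suc.IH) auto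
        then show ?thesis
          using 1 True ce pw by (simp add: buys_def)
      next
        case 2: False
        have "permutation_prob (A - {e}) (\<lambda>xs. \<theta> < card (uncovered \<theta> U (take t xs))) \<le> ?b"
          using Suc.prems 2 pA by (intro Suc.IH) auto
        then show ?thesis
          using 2 True by (simp add: buys_def)
      qed
    qed
    have "permutation_prob A (\<lambda>xs. \<theta> < card (uncovered \<theta> U (take (Suc t) xs)))
        \<le> (\<Sum>e\<in>A. if e \<in> ?E then ?b / z else ?b) / card A"
      unfolding prob_permutation_Cons[OF Suc.prems(2) \<open>A \<noteq> {}\<close>]
      by (intro divide_right_mono sum_mono step) auto
    also have "(\<Sum>e\<in>A. if e \<in> ?E then ?b / z else ?b) = real (card ?E) * (?b / z) + (real (card A) - real (card ?E)) * ?b"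
    proof -
      have "A \<inter> {e. e \<in> ?E} = ?E" "A \<inter> - {e. e \<in> ?E} = A - ?E"
        using EA by auto
      then show ?thesis
        using EA Suc.prems(2) by (simp add: sum.If_cases card_Diff_subset card_mono of_nat_diff)
    qed
    also have "\<dots> / card A = ?b * (1 - card ?E / card A * (1 - 1 / z))"
    proof -
      have "(k * (b / z) + (a - k) * b) / a = b * (1 - k / a * (1 - 1 / z))"
        if "a > 0" for a b k :: real
        using that assms(6) by (simp add: field_simps)
      from this[OF cA] show ?thesis .
    qed
    also have "\<dots> \<le> ?b * ?r"
    proof -
      have "p \<le> card ?E / card A"
        using pE cA by (simp add: field_simps)
      then have "p * (1 - 1 / z) \<le> card ?E / card A * (1 - 1 / z)"
        using assms(6) by (intro mult_right_mono) auto
      then show ?thesis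
        using b0 by (intro mult_left_mono) auto
    qed
    finally show ?thesis
      by (simp add: mult_ac)
  qed
qed

text \<open>The second product is the probability that the first \<open>a\<close> elements avoid
  \<open>S\<close>; the first one is the conditional probability that the first \<open>m\<close> of
  them also avoid \<open>S'\<close>. The proof conditions on the first element.\<close>

lemma permutation_prob_avoid:
  fixes S S' :: "'a set"
  assumes "finite A" "S \<subseteq> A" "S' \<subseteq> A" "S \<inter> S' = {}" "m \<le> a" "a \<le> card A"
  shows "permutation_prob A (\<lambda>xs. set (take m xs) \<inter> S' = {} \<and> set (take a xs) \<inter> S = {}) =
    (\<Prod>i<m. 1 - card S' / (real (card A) - card S - real i)) * (\<Prod>i<a. 1 - card S / (real (card A) - real i))"
  using assms
proof (induction a arbitrary: A m S')
  case 0
  then show ?case by simp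
next
  case (Suc a)
  have "A \<noteq> {}" using Suc.prems by auto
  define N d d' where "N = real (card A)" and "d = real (card S)" and "d' = real (card S')"
  have N: "N \<ge> 1"
    using \<open>A \<noteq> {}\<close> Suc.prems(1) by (simp add: N_def Suc_le_eq card_gt_0_iff)
  have fin: "finite S" "finite S'"
    using Suc.prems finite_subset by blast+
  have dN: "d + d' \<le> N"
  proof -
    have "card (S \<union> S') \<le> card A"
      using Suc.prems by (intro card_mono) auto
    then show ?thesis
      using fin Suc.prems(4) by (simp add: card_Un_disjoint N_def d_def d'_def)
  qed
  have cA: "real (card (A - {x})) = N - 1" if "x \<in> A" for x
    using that Suc.prems(1) N by (simp add: N_def card_Diff_singleton_if of_nat_diff)
  let ?R = "\<lambda>xs. set (take m xs) \<inter> S' = {} \<and> set (take (Suc a) xs) \<inter> S = {}"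
  show ?case
  proof (cases m)
    case 0
    \<comment> \<open>For \<open>m = 0\<close> the element \<open>x\<close> may belong to
      \<open>S'\<close>, which then fails to be a subset of \<open>A - {x}\<close>. The induction
      hypothesis is therefore taken with the empty set in place of \<open>S'\<close>.\<close>
    have IH: "permutation_prob (A - {x}) (\<lambda>xs. ?R (x # xs)) =
        (if x \<in> S then 0 else (\<Prod>i<a. 1 - d / (N - 1 - real i)))" if x: "x \<in> A" for x
      using Suc.IH[of "A - {x}" "{}" 0] Suc.prems x cA[OF x] 0 by (auto simp: d_def subset_Diff_insert)
    have "permutation_prob A ?R = (\<Sum>x\<in>A. if x \<in> S then 0 else (\<Prod>i<a. 1 - d / (N - 1 - real i))) / N"
      unfolding prob_permutation_Cons[OF Suc.prems(1) \<open>A \<noteq> {}\<close>] N_def[symmetric]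
      by (intro arg_cong2[of _ _ _ _ "(/)"] sum.cong IH refl)
    also have "\<dots> = (N - d) / N * (\<Prod>i<a. 1 - d / (N - 1 - real i))"
    proof -
      have "A \<inter> - S = A - S" by auto
      then show ?thesis
        using fin Suc.prems by (simp add: sum.If_cases card_Diff_subset card_mono of_nat_diff N_def d_def)
    qed
    also have "\<dots> = (\<Prod>i<Suc a. 1 - d / (N - real i))"
      using N unfolding prod.lessThan_Suc_shift by (simp add: diff_divide_distrib algebra_simps)
    finally show ?thesis
      using 0 by (simp add: N_def d_def)
  next
    case (Suc m')
    have IH: "permutation_prob (A - {x}) (\<lambda>xs. ?R (x # xs)) =
        (if x \<in> S \<union> S' then 0 else
          (\<Prod>i<m'. 1 - d' / (N - 1 - d - real i)) * (\<Prod>i<a. 1 - d / (N - 1 - real i)))" if x: "x \<in> A" for x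
      using Suc.IH[of "A - {x}" S' m'] Suc.prems x cA[OF x] \<open>m = Suc m'\<close> by (auto simp: d_def d'_def subset_Diff_insert)
    have "permutation_prob A ?R = (\<Sum>x\<in>A. if x \<in> S \<union> S' then 0 else
          (\<Prod>i<m'. 1 - d' / (N - 1 - d - real i)) * (\<Prod>i<a. 1 - d / (N - 1 - real i))) / N"
      unfolding prob_permutation_Cons[OF Suc.prems(1) \<open>A \<noteq> {}\<close>] N_def[symmetric]
      by (intro arg_cong2[of _ _ _ _ "(/)"] sum.cong IH refl)
    also have "\<dots> = (N - d - d') / N *
        ((\<Prod>i<m'. 1 - d' / (N - 1 - d - real i)) * (\<Prod>i<a. 1 - d / (N - 1 - real i)))"
    proof -
      have "A \<inter> - (S \<union> S') = A - (S \<union> S')" by auto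
      moreover have "real (card (A - (S \<union> S'))) = N - d - d'"
        using fin Suc.prems dN
        by (subst card_Diff_subset) (auto simp: card_Un_disjoint of_nat_diff N_def d_def d'_def)
      ultimately show ?thesis
        using Suc.prems by (simp add: sum.If_cases del: Un_iff)
    qed
    also have "(N - d - d') / N = (1 - d' / (N - d)) * (1 - d / N)"
    \<comment> \<open>If \<open>N = d\<close>, then \<open>d' = 0\<close>, and with division by zero
      yielding 0 both sides vanish.\<close>
    proof (cases "N = d")
      case True
      then show ?thesis using dN d'_def N by simp
    next
      case False
      then show ?thesis using N by (simp add: field_simps)
    qed
    also have "(1 - d' / (N - d)) * (1 - d / N) *
        ((\<Prod>i<m'. 1 - d' / (N - 1 - d - real i)) * (\<Prod>i<a. 1 - d / (N - 1 - real i))) =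
        (\<Prod>i<Suc m'. 1 - d' / (N - d - real i)) * (\<Prod>i<Suc a. 1 - d / (N - real i))"
    proof -
      have eq: "N - 1 - d - real i = N - d - real (Suc i)" "N - 1 - real i = N - real (Suc i)" for i
        by simp_all
      then show ?thesis
        unfolding prod.lessThan_Suc_shift eq by (simp add: mult_ac)
    qed
    finally show ?thesis
      using Suc by (simp add: N_def d_def d'_def)
  qed
qed

text \<open>Moving the block of \<open>m\<close> elements after position \<open>T\<close> to the
  front is a bijection on the orderings. It keeps the set of the first \<open>T + a\<close>
  elements, because \<open>m \<le> a\<close>.\<close>

lemma permutation_prob_block_swap:
  assumes "finite A" "m \<le> a" "T + a \<le> card A"
  shows "permutation_prob A (\<lambda>xs. Q (set (take m (drop T xs))) (set (take (T + a) xs))) =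
         permutation_prob A (\<lambda>xs. Q (set (take m xs)) (set (take (T + a) xs)))"
proof -
  let ?g = "\<lambda>xs. take m (drop T xs) @ take T xs @ drop (T + m) xs"
  let ?P = "permutations_of_set A"
  have len: "length xs = card A" if "xs \<in> ?P" for xs
    using that by (rule length_finite_permutations_of_set)
  have parts: "xs = take T xs @ take m (drop T xs) @ drop (T + m) xs" for xs :: "'a list"
    by (metis append_take_drop_id drop_drop add.commute)
  have "?g xs \<in> ?P" if "xs \<in> ?P" for xs
  proof -
    have "mset (?g xs) = mset (take T xs @ take m (drop T xs) @ drop (T + m) xs)"
      by simp
    then have "mset (?g xs) = mset xs"
      using parts[of xs] by simp
    then have "set (?g xs) = set xs" "distinct (?g xs) = distinct xs"
      using mset_eq_setD mset_eq_imp_distinct_iff by blast+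
    then show ?thesis
      using that by (auto simp only: permutations_of_set_def mem_Collect_eq)
  qed
  moreover have inj: "inj_on ?g ?P"
  proof (rule inj_onI)
    fix xs ys assume "xs \<in> ?P" "ys \<in> ?P" and eq: "?g xs = ?g ys"
    \<comment> \<open>With equal lengths the three blocks of the two lists line up, so the equation
      splits into one for each block.\<close>
    then have "length xs = length ys"
      by (simp add: len)
    then have "take m (drop T xs) = take m (drop T ys)" "take T xs = take T ys"
        "drop (T + m) xs = drop (T + m) ys"
      using eq by auto
    then show "xs = ys"
      using parts[of xs] parts[of ys] by simp
  qed
  ultimately have "?g ` ?P = ?P"
    by (intro endo_inj_surj) auto
  then have map: "map_pmf ?g (pmf_of_set ?P) = pmf_of_set ?P"
    using inj assms(1) by (subst map_pmf_of_set_inj) auto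
  have "permutation_prob A (\<lambda>xs. Q (set (take m xs)) (set (take (T + a) xs))) =
      permutation_prob A (\<lambda>xs. Q (set (take m (?g xs))) (set (take (T + a) (?g xs))))"
    by (subst map[symmetric]) (simp only: measure_map_pmf vimage_Collect_eq)
  also have "\<dots> = permutation_prob A (\<lambda>xs. Q (set (take m (drop T xs))) (set (take (T + a) xs)))"
  proof (rule measure_pmf.finite_measure_eq_AE)
    have "set (take m (?g xs)) = set (take m (drop T xs)) \<and>
        set (take (T + a) (?g xs)) = set (take (T + a) xs)" if "xs \<in> ?P" for xs
    proof -
      have m: "length (take m (drop T xs)) = m" "length (take T xs) = T"
        using assms len[OF that] by auto
      have "take (T + a) (?g xs) = take m (drop T xs) @ take T xs @ take (a - m) (drop (T + m) xs)"
        using m assms(2) by simp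
      moreover have "take (T + a) (take T xs @ take m (drop T xs) @ drop (T + m) xs) =
          take T xs @ take m (drop T xs) @ take (a - m) (drop (T + m) xs)"
        using m assms(2) by simp
      ultimately have "set (take (T + a) (?g xs)) = set (take (T + a) xs)"
        using parts[of xs] by (simp only: set_append Un_left_commute)
      moreover have "take m (?g xs) = take m (drop T xs)"
        using m by simp
      ultimately show ?thesis by (simp only: simp_thms)
    qed
    then show "AE xs in measure_pmf (pmf_of_set ?P).
        (xs \<in> {xs. Q (set (take m (?g xs))) (set (take (T + a) (?g xs)))}) =
        (xs \<in> {xs. Q (set (take m (drop T xs))) (set (take (T + a) xs))})"
      using assms(1) by (auto simp: AE_measure_pmf_iff)
  qed auto
  finally show ?thesis by simp
qed

section \<open>The vertex that is covered last\<close>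

text \<open>The probability that a fixed vertex is isolated after \<open>a\<close> edges (see
  \<open>prob_isolated\<close>). Each factor is the conditional probability that one more edge
  avoids the \<open>n - 1\<close> edges at the vertex.\<close>

definition isolated_prob :: "nat \<Rightarrow> nat \<Rightarrow> real" where
  "isolated_prob n a = (\<Prod>i<a. 1 - (real n - 1) / (real (n choose 2) - real i))"

text \<open>Such an edge is determined by its end other than \<open>v\<close>. The cases in use are
  an empty \<open>W\<close> and a singleton.\<close>

lemma card_star:
  assumes "v \<in> {1..n}" "W \<subseteq> {1..n}" "v \<notin> W"
  shows "card {e \<in> complete_edges n. v \<in> e \<and> e \<inter> W = {}} = n - 1 - card W"
proof -
  have "{e \<in> complete_edges n. v \<in> e \<and> e \<inter> W = {}} = (\<lambda>u. {v, u}) ` ({1..n} - insert v W)"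
  proof (intro equalityI subsetI)
    fix e assume e: "e \<in> {e \<in> complete_edges n. v \<in> e \<and> e \<inter> W = {}}"
    then obtain x y where "e = {x, y}" "x \<noteq> y"
      by (auto simp: complete_edges_def card_2_iff)
    with e show "e \<in> (\<lambda>u. {v, u}) ` ({1..n} - insert v W)"
      by (auto simp: complete_edges_def image_iff doubleton_eq_iff)
  next
    fix e assume "e \<in> (\<lambda>u. {v, u}) ` ({1..n} - insert v W)"
    with assms show "e \<in> {e \<in> complete_edges n. v \<in> e \<and> e \<inter> W = {}}"
      by (auto simp: complete_edges_def)
  qed
  moreover have "inj_on (\<lambda>u. {v, u}) ({1..n} - insert v W)"
    by (auto simp: inj_on_def doubleton_eq_iff)
  moreover have "finite W"
    using assms(2) by (rule finite_subset) simp
  ultimately show ?thesis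
    using assms by (simp add: card_image card_Diff_subset)
qed

text \<open>Moving the block after time \<open>T\<close> to the front makes the two avoidance conditions nested, so that
  the probability is a product.\<close>

lemma prob_isolated_uncovered:
  assumes "v \<in> {1..n}" "w \<in> {1..n}" "w \<noteq> v" "m \<le> a" "T + a \<le> n choose 2"
  shows "measure_pmf.prob (edge_process n)
      {es. v \<notin> \<Union>(set (take (T + a) es)) \<and> w \<notin> \<Union>(set (take m (drop T es)))} =
    isolated_prob n (T + a) * (\<Prod>i<m. 1 - (real n - 2) / (real (n choose 2) - (real n - 1) - real i))"
proof -
  let ?K = "complete_edges n"
  \<comment> \<open>Leaving the edge between \<open>v\<close> and \<open>w\<close> out of
    \<open>?S'\<close> makes the two sets disjoint, as \<open>permutation_prob_avoid\<close>
    demands. No event changes, since that edge is already excluded while \<open>v\<close> is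
    isolated.\<close>
  let ?S = "{e \<in> ?K. v \<in> e}" and ?S' = "{e \<in> ?K. w \<in> e \<and> e \<inter> {v} = {}}"
  let ?Q = "\<lambda>X Y. X \<inter> ?S' = {} \<and> Y \<inter> ?S = {}"
  have n: "n \<ge> 2" using assms(1-3) by auto
  have cS: "real (card ?S) = real n - 1"
    using card_star[of v n "{}"] assms(1) n by (simp add: of_nat_diff)
  have cS': "real (card ?S') = real n - 2"
    using card_star[of w n "{v}"] assms(1-3) n by (simp add: of_nat_diff)
  have "measure_pmf.prob (edge_process n)
      {es. v \<notin> \<Union>(set (take (T + a) es)) \<and> w \<notin> \<Union>(set (take m (drop T es)))} =
    permutation_prob ?K (\<lambda>es. ?Q (set (take m (drop T es))) (set (take (T + a) es)))"
    unfolding edge_process_def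
  proof (rule measure_pmf.finite_measure_eq_AE)
    have "(v \<notin> \<Union>(set (take (T + a) es)) \<and> w \<notin> \<Union>(set (take m (drop T es)))) =
        ?Q (set (take m (drop T es))) (set (take (T + a) es))" if "es \<in> permutations_of_set ?K" for es
    proof -
      have sub: "set (take (T + a) es) \<subseteq> ?K"
        using that set_take_subset[of "T + a" es] by (auto simp: permutations_of_set_def)
      have sub': "set (take m (drop T es)) \<subseteq> set (take (T + a) es)"
      proof -
        have "take m (drop T es) = drop T (take (T + m) es)"
          by (simp add: drop_take)
        then have "set (take m (drop T es)) \<subseteq> set (take (T + m) es)"
          by (metis set_drop_subset)
        also have "\<dots> \<subseteq> set (take (T + a) es)"
          using assms(4) by (intro set_take_subset_set_take) simp
        finally show ?thesis .
      qed
      show ?thesis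
      proof -
        have v: "v \<notin> \<Union>Y \<longleftrightarrow> Y \<inter> ?S = {}" if "Y \<subseteq> ?K" for Y
          using that by blast
        have w: "w \<notin> \<Union>X \<longleftrightarrow> X \<inter> ?S' = {}" if "X \<subseteq> ?K" "v \<notin> \<Union>X" for X
          using that by blast
        show ?thesis
        proof (cases "v \<notin> \<Union>(set (take (T + a) es))")
          case True
          then have "v \<notin> \<Union>(set (take m (drop T es)))"
            using Union_mono[OF sub'] by (rule contra_subsetD[rotated])
          from w[OF order_trans[OF sub' sub] this] v[OF sub] True show ?thesis
            by (simp only: simp_thms)
        next
          case False
          with v[OF sub] show ?thesis by (simp only: simp_thms)
        qed
      qed
    qed
    then show "AE es in measure_pmf (pmf_of_set (permutations_of_set ?K)).
        (es \<in> {es. v \<notin> \<Union>(set (take (T + a) es)) \<and> w \<notin> \<Union>(set (take m (drop T es)))}) =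
        (es \<in> {es. ?Q (set (take m (drop T es))) (set (take (T + a) es))})"
      by (simp add: AE_measure_pmf_iff)
  qed auto
  also have "\<dots> = permutation_prob ?K (\<lambda>es. ?Q (set (take m es)) (set (take (T + a) es)))"
    using assms by (intro permutation_prob_block_swap) (auto simp: card_complete_edges)
  also have "\<dots> = (\<Prod>i<m. 1 - card ?S' / (real (card ?K) - card ?S - real i)) *
      (\<Prod>i<T + a. 1 - card ?S / (real (card ?K) - real i))"
    using assms by (intro permutation_prob_avoid) (auto simp: card_complete_edges)
  finally show ?thesis
    unfolding cS cS' card_complete_edges isolated_prob_def by (simp only: mult.commute)
qed

section \<open>Isolation of a single vertex and bounds for the products\<close>

lemma prob_isolated:
  assumes "v \<in> {1..n}" "n \<ge> 2" "a \<le> n choose 2"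
  shows "measure_pmf.prob (edge_process n) {es. v \<notin> \<Union>(set (take a es))} = isolated_prob n a"
proof -
  \<comment> \<open>Any second vertex will do: for \<open>m = 0\<close> the condition on it is
    vacuous.\<close>
  have "(if v = 1 then 2 else 1) \<in> {1..n}" "(if v = 1 then 2 else 1) \<noteq> v"
    using assms by auto
  from prob_isolated_uncovered[OF assms(1) this, of 0 a 0] assms(3) show ?thesis
    by simp
qed

text \<open>The factor for \<open>i = 0\<close> is exactly \<open>1 - 2 / (real n - 1)\<close>, and
  the factors decrease in \<open>i\<close>. The slack \<open>2 * n\<close> keeps them
  nonnegative.\<close>

lemma isolated_uncovered_factor_le:
  assumes "n \<ge> 3" "m + 2 * n \<le> n choose 2"
  shows "(\<Prod>i<m. 1 - (real n - 2) / (real (n choose 2) - (real n - 1) - real i))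
    \<le> (1 - 2 / (real n - 1)) ^ m"
proof -
  have N: "real (n choose 2) - (real n - 1) = (real n - 1) * (real n - 2) / 2"
    by (simp add: real_choose_two field_simps)
  have cancel: "b / (a * b / 2) = 2 / a" if "b \<noteq> 0" for a b :: real
    using that by simp
  have m: "real m + 2 * real n \<le> real (n choose 2)"
    using assms(2) by (metis of_nat_add of_nat_le_iff of_nat_mult of_nat_numeral)
  have "(\<Prod>i<m. 1 - (real n - 2) / (real (n choose 2) - (real n - 1) - real i))
      \<le> (\<Prod>i<m. 1 - 2 / (real n - 1))"
  proof (rule prod_mono)
    fix i assume "i \<in> {..<m}"
    then have "real i \<le> real m" by simp
    define D where "D = real (n choose 2) - (real n - 1) - real i"
    have D: "real n - 2 \<le> D" "D \<le> (real n - 1) * (real n - 2) / 2"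
      using m \<open>real i \<le> real m\<close> N by (auto simp: D_def)
    have "2 / (real n - 1) = (real n - 2) / ((real n - 1) * (real n - 2) / 2)"
      using assms(1) by (intro cancel[symmetric]) simp
    also have "\<dots> \<le> (real n - 2) / D"
      using D assms(1) by (intro divide_left_mono) auto
    finally have "2 / (real n - 1) \<le> (real n - 2) / D" .
    then show "0 \<le> 1 - (real n - 2) / (real (n choose 2) - (real n - 1) - real i) \<and>
        1 - (real n - 2) / (real (n choose 2) - (real n - 1) - real i) \<le> 1 - 2 / (real n - 1)"
      using D assms(1) unfolding D_def[symmetric] by simp
  qed
  then show ?thesis by simp
qed

text \<open>The factors decrease in \<open>i\<close>, so they lie between the value at
  \<open>i = a\<close> and the value \<open>1 - 2 / real n\<close> at \<open>i = 0\<close>.\<close>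

lemma isolated_prob_bounds:
  assumes "n \<ge> 2" "a + 2 * n \<le> n choose 2"
  shows "isolated_prob n a \<le> (1 - 2 / real n) ^ a"
    and "(1 - (real n - 1) / (real (n choose 2) - real a)) ^ a \<le> isolated_prob n a"
proof -
  have cancel: "b / (a * b / 2) = 2 / a" if "b \<noteq> 0" for a b :: real
    using that by simp
  have a: "real a + 2 * real n \<le> real (n choose 2)"
    using assms(2) by (metis of_nat_add of_nat_le_iff of_nat_mult of_nat_numeral)
  have *: "0 \<le> 1 - (real n - 1) / (real (n choose 2) - real a) \<and>
     1 - (real n - 1) / (real (n choose 2) - real a) \<le> 1 - (real n - 1) / (real (n choose 2) - real i) \<and>
     1 - (real n - 1) / (real (n choose 2) - real i) \<le> 1 - 2 / real n" if "i < a" for i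
  proof -
    have i: "real i \<le> real a" using that by simp
    have "(real n - 1) / (real (n choose 2) - real i) \<le> (real n - 1) / (real (n choose 2) - real a)"
      using a i assms(1) by (intro divide_left_mono) auto
    moreover have "(real n - 1) / real (n choose 2) \<le> (real n - 1) / (real (n choose 2) - real i)"
      using a i assms(1) by (intro divide_left_mono mult_pos_pos) auto
    moreover have "(real n - 1) / real (n choose 2) = 2 / real n"
      unfolding real_choose_two using assms(1) by (intro cancel) simp
    moreover have "(real n - 1) / (real (n choose 2) - real a) \<le> 1"
      using a assms(1) by (simp add: divide_le_eq_1)
    ultimately show ?thesis by simp
  qed
  have "isolated_prob n a \<le> (\<Prod>i<a. 1 - 2 / real n)"
    unfolding isolated_prob_def using * by (intro prod_mono) (meson lessThan_iff order_trans)
  then show "isolated_prob n a \<le> (1 - 2 / real n) ^ a" by simp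
  have "(\<Prod>i<a. 1 - (real n - 1) / (real (n choose 2) - real a)) \<le> isolated_prob n a"
    unfolding isolated_prob_def using * by (intro prod_mono) auto
  then show "(1 - (real n - 1) / (real (n choose 2) - real a)) ^ a \<le> isolated_prob n a" by simp
qed

text \<open>The event is split according to the vertex \<open>v\<close> that is covered last and the level \<open>i\<close> such that
  \<open>v\<close> is covered between the times \<open>T + m i\<close> and \<open>T + m (Suc i)\<close>, all other vertices having been
  covered in between \<open>T\<close> and \<open>T + m i\<close>.\<close>

lemma prob_last_isolated_ge:
  fixes m :: "nat \<Rightarrow> nat"
  assumes n: "n \<ge> 3" and m: "mono m" "T + m k + 2 * n \<le> n choose 2"
  shows "measure_pmf.prob (edge_process n) {es. last_isolated n T es} \<ge>
    real n * (\<Sum>i<k. (isolated_prob n (T + m i) - isolated_prob n (T + m (Suc i))) *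
      (1 - (real n - 1) * (1 - 2 / (real n - 1)) ^ m i))"
proof -
  let ?P = "measure_pmf.prob (edge_process n)"
  \<comment> \<open>\<open>I v i\<close>: the vertex \<open>v\<close> is isolated at time
    \<open>T + m i\<close>. \<open>W w i\<close>: the vertex \<open>w\<close> is missed by the first
    \<open>m i\<close> edges after time \<open>T\<close>.\<close>
  define I where "I = (\<lambda>(v::nat) i. {es. v \<notin> \<Union>(set (take (T + m i) es))})"
  define W where "W = (\<lambda>(w::nat) i. {es. w \<notin> \<Union>(set (take (m i) (drop T es)))})"
  let ?D = "\<lambda>(v, i). (I v i - I v (Suc i)) - (\<Union>w\<in>{1..n}-{v}. W w i)"
  let ?q = "\<lambda>i. (1 - 2 / (real n - 1)) ^ m i"
  let ?p = "\<lambda>i. isolated_prob n (T + m i)"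
  have n2: "n \<ge> 2"
    using n by simp
  have mk: "m i \<le> m j" if "i \<le> j" for i j
    using m(1) that by (rule monoD)
  have Imono: "I v j \<subseteq> I v i" if "i \<le> j" for v i j
    using set_take_subset_set_take[of "T + m i" "T + m j"] mk[OF that]
    unfolding I_def by fastforce
  have P_D: "(?p i - ?p (Suc i)) * (1 - (real n - 1) * ?q i) \<le> ?P (?D (v, i))"
    if v: "v \<in> {1..n}" and i: "i < k" for v i
  proof -
    have mi: "m i \<le> m (Suc i)" "m (Suc i) \<le> m k"
      using i by (auto intro: mk)
    have le: "T + m i \<le> n choose 2" "T + m (Suc i) \<le> n choose 2" "m i + 2 * n \<le> n choose 2"
      using mi m(2) by linarith+
    define r where "r = (\<Prod>j<m i. 1 - (real n - 2) / (real (n choose 2) - (real n - 1) - real j))"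
    have rq: "r \<le> ?q i"
      unfolding r_def using n le by (intro isolated_uncovered_factor_le)
    have PI: "?P (I v i - I v (Suc i)) = ?p i - ?p (Suc i)"
    proof -
      have "?P (I v i - I v (Suc i)) = ?P (I v i) - ?P (I v (Suc i))"
        by (intro measure_pmf.finite_measure_Diff Imono) simp_all
      then show ?thesis
        by (simp only: I_def prob_isolated[OF v n2 le(1)] prob_isolated[OF v n2 le(2)])
    qed
    then have nonneg: "?p i - ?p (Suc i) \<ge> 0"
      by (metis measure_nonneg)
    have PW: "?P ((I v i - I v (Suc i)) \<inter> W w i) = (?p i - ?p (Suc i)) * r"
      if w: "w \<in> {1..n} - {v}" for w
    proof -
      \<comment> \<open>The factor \<open>r\<close> depends on \<open>m i\<close> but not on
        \<open>j\<close>, so it comes out of the difference of the cases \<open>j = i\<close> and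
        \<open>j = Suc i\<close>.\<close>
      have joint: "?P (I v j \<inter> W w i) = ?p j * r" if "i \<le> j" "T + m j \<le> n choose 2" for j
        using prob_isolated_uncovered[OF v, of w "m i" "m j" T] w mk[OF that(1)] that(2)
        unfolding Collect_conj_eq r_def I_def W_def by auto
      have "(I v i - I v (Suc i)) \<inter> W w i = (I v i \<inter> W w i) - (I v (Suc i) \<inter> W w i)"
        by (rule Diff_Int_distrib2)
      then have "?P ((I v i - I v (Suc i)) \<inter> W w i) =
          ?P ((I v i \<inter> W w i) - (I v (Suc i) \<inter> W w i))"
        by (rule arg_cong)
      also have "\<dots> = ?P (I v i \<inter> W w i) - ?P (I v (Suc i) \<inter> W w i)"
        by (rule measure_pmf.finite_measure_Diff[OF _ _ Int_mono[OF Imono subset_refl]]) simp_all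
      also have "\<dots> = ?p i * r - ?p (Suc i) * r"
        unfolding joint[OF order_refl le(1)] joint[OF le_SucI[OF order_refl] le(2)] ..
      finally show ?thesis
        by (simp add: left_diff_distrib)
    qed
    let ?B = "\<Union>w\<in>{1..n}-{v}. (I v i - I v (Suc i)) \<inter> W w i"
    have "?P (I v i - I v (Suc i)) \<le> ?P (?D (v, i) \<union> ?B)"
      by (intro measure_pmf.finite_measure_mono) auto
    also have "\<dots> \<le> ?P (?D (v, i)) + ?P ?B"
      by (intro measure_subadditive) auto
    also have "?P ?B \<le> (\<Sum>w\<in>{1..n}-{v}. ?P ((I v i - I v (Suc i)) \<inter> W w i))"
      by (intro measure_pmf.finite_measure_subadditive_finite) auto
    also have "\<dots> = (\<Sum>w\<in>{1..n}-{v}. (?p i - ?p (Suc i)) * r)"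
      by (intro sum.cong refl PW)
    also have "\<dots> = (?p i - ?p (Suc i)) * ((real n - 1) * r)"
      using v n by (simp add: of_nat_diff)
    also have "\<dots> \<le> (?p i - ?p (Suc i)) * ((real n - 1) * ?q i)"
      using nonneg rq n by (intro mult_left_mono) auto
    finally show ?thesis
      unfolding PI by (simp add: algebra_simps)
  qed
  have disj: "disjoint_family_on ?D ({1..n} \<times> {..<k})"
  proof -
    \<comment> \<open>For one vertex, distinct levels exclude each other. For two vertices,
      \<open>v'\<close> would have to be isolated at time \<open>T + m j\<close> although an edge
      between \<open>T\<close> and \<open>T + m i\<close> covers it.\<close>
    have cross: "?D (v, i) \<inter> ?D (v', j) = {}"
      if "(v, i) \<noteq> (v', j)" "i \<le> j" "v \<in> {1..n}" "v' \<in> {1..n}" for v v' i j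
    proof (cases "v = v'")
      case True
      then have "Suc i \<le> j" using that by auto
      then show ?thesis using Imono[of "Suc i" j v] True by auto
    next
      case False
      have "I v' j \<subseteq> W v' i"
      proof -
        have "set (take (m i) (drop T es)) \<subseteq> set (take (T + m j) es)" for es :: "edge list"
        proof -
          have "take (m i) (drop T es) = drop T (take (T + m i) es)"
            by (simp add: drop_take)
          then have "set (take (m i) (drop T es)) \<subseteq> set (take (T + m i) es)"
            by (metis set_drop_subset)
          also have "\<dots> \<subseteq> set (take (T + m j) es)"
            using mk[OF that(2)] by (intro set_take_subset_set_take) simp
          finally show ?thesis .
        qed
        then show ?thesis
          unfolding I_def W_def by blast
      qed
      then show ?thesis using False that by auto
    qed
    have "?D x \<inter> ?D y = {}" if "x \<in> {1..n} \<times> {..<k}" "y \<in> {1..n} \<times> {..<k}" "x \<noteq> y" for x y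
    proof -
      obtain v i v' j where xy: "x = (v, i)" "y = (v', j)" by fastforce
      show ?thesis
      proof (cases "i \<le> j")
        case True
        then show ?thesis
          using that unfolding xy by (intro cross) auto
      next
        case False
        then have "?D (v', j) \<inter> ?D (v, i) = {}"
          using that unfolding xy by (intro cross) auto
        then show ?thesis
          unfolding xy by (subst Int_commute)
      qed
    qed
    then show ?thesis
      unfolding disjoint_family_on_def by blast
  qed
  have "real n * (\<Sum>i<k. (?p i - ?p (Suc i)) * (1 - (real n - 1) * ?q i)) =
      (\<Sum>v\<in>{1..n}. \<Sum>i<k. (?p i - ?p (Suc i)) * (1 - (real n - 1) * ?q i))"
    by simp
  also have "\<dots> \<le> (\<Sum>v\<in>{1..n}. \<Sum>i<k. ?P (?D (v, i)))"
    by (intro sum_mono P_D) auto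
  also have "\<dots> = (\<Sum>x\<in>{1..n} \<times> {..<k}. ?P (?D x))"
    by (simp add: sum.cartesian_product split_def)
  also have "\<dots> = ?P (\<Union>x\<in>{1..n} \<times> {..<k}. ?D x)"
    using disj by (intro measure_pmf.finite_measure_finite_Union[symmetric]) auto
  also have "\<dots> \<le> ?P {es. last_isolated n T es}"
  proof (rule measure_pmf.finite_measure_mono)
    have "last_isolated n T es" if "v \<in> {1..n}" "es \<in> ?D (v, i)" for v i es
      unfolding last_isolated_def
      using that by (intro bexI[of _ v] exI[of _ "m i"]) (auto simp: I_def W_def)
    then show "(\<Union>x\<in>{1..n} \<times> {..<k}. ?D x) \<subseteq> {es. last_isolated n T es}"
      by fast
  qed simp
  finally show ?thesis .
qed

section \<open>Asymptotics\<close>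

text \<open>The scale at which the expected number of isolated vertices tends to
  \<open>exp (- c)\<close>. The slack of 2 absorbs the rounding of a sum of two ceilings.\<close>

definition coupon_window :: "real \<Rightarrow> (nat \<Rightarrow> nat) \<Rightarrow> bool" where
  "coupon_window c f \<longleftrightarrow> (\<forall>\<^sub>F n in sequentially.
     real n / 2 * (ln n + c) \<le> real (f n) \<and> real (f n) \<le> real n / 2 * (ln n + c) + 2)"

text \<open>Since the base is at most 1, powers decrease in the exponent. This trades integer
  exponents for real ones with an explicit formula, whose limits can be computed.\<close>

lemma powr_window:
  assumes "0 < x" "x \<le> 1" "l \<le> real k" "real k \<le> u"
  shows "x ^ k \<le> x powr l" "x powr u \<le> x ^ k"
  using assms by (auto simp: powr_mono' simp flip: powr_realpow)

lemma coupon_window_small: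
  assumes "coupon_window c f"
  shows "\<forall>\<^sub>F n in sequentially. f n + 2 * n \<le> n choose 2"
proof -
  have "\<forall>\<^sub>F n in sequentially. (real n / 2 * (ln n + c) + 2) + 2 * real n \<le> real n * (real n - 1) / 2"
    by real_asymp
  then show ?thesis
    using assms unfolding coupon_window_def
  proof eventually_elim
    case (elim n)
    then have "real (f n + 2 * n) \<le> real (n choose 2)"
      by (simp add: real_choose_two)
    then show ?case
      by (simp only: of_nat_le_iff)
  qed
qed

text \<open>Both bounds of \<open>isolated_prob_bounds\<close> become explicit functions of
  \<open>n\<close> when \<open>f n\<close> is replaced by an end of its window, and both limits are
  \<open>exp (- c)\<close>.\<close>

lemma isolated_prob_limit:
  assumes "coupon_window c f"
  shows "(\<lambda>n. real n * isolated_prob n (f n)) \<longlonglongrightarrow> exp (-c)"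
proof (rule tendsto_sandwich)
  let ?l = "\<lambda>n. real n / 2 * (ln (real n) + c)"
  \<comment> \<open>This is the smallest factor, with \<open>f n\<close> replaced by the upper end
    of its window.\<close>
  let ?x = "\<lambda>n. 1 - (real n - 1) / (real n * (real n - 1) / 2 - (?l n + 2))"
  show "\<forall>\<^sub>F n in sequentially. real n * isolated_prob n (f n) \<le> real n * (1 - 2 / real n) powr ?l n"
    using coupon_window_small[OF assms] assms[unfolded coupon_window_def] eventually_gt_at_top[of 2]
  proof eventually_elim
    case (elim n)
    then have "isolated_prob n (f n) \<le> (1 - 2 / real n) ^ f n"
      by (intro isolated_prob_bounds) auto
    also have "\<dots> \<le> (1 - 2 / real n) powr ?l n"
      using elim by (intro powr_window) (auto simp: field_simps)
    finally show ?case
      by (intro mult_left_mono) auto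
  qed
  have "\<forall>\<^sub>F n in sequentially. 0 < ?x n" "\<forall>\<^sub>F n in sequentially. ?x n \<le> 1"
    "\<forall>\<^sub>F n in sequentially. 0 < real n * (real n - 1) / 2 - (?l n + 2)"
    by real_asymp+
  then show "\<forall>\<^sub>F n in sequentially. real n * ?x n powr (?l n + 2) \<le> real n * isolated_prob n (f n)"
    using coupon_window_small[OF assms] assms[unfolded coupon_window_def] eventually_gt_at_top[of 2]
  proof eventually_elim
    case (elim n)
    have "?x n powr (?l n + 2) \<le> ?x n ^ f n"
      using elim by (intro powr_window(2)[of _ "?l n"]) auto
    also have "?x n \<le> 1 - (real n - 1) / (real (n choose 2) - real (f n))"
      unfolding real_choose_two using elim by (intro diff_left_mono divide_left_mono mult_pos_pos) auto
    then have "?x n ^ f n \<le> (1 - (real n - 1) / (real (n choose 2) - real (f n))) ^ f n"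
      using elim by (intro power_mono) auto
    also have "\<dots> \<le> isolated_prob n (f n)"
      using elim by (intro isolated_prob_bounds) auto
    finally show ?case
      by (intro mult_left_mono) auto
  qed
  show "(\<lambda>n. real n * (1 - 2 / real n) powr ?l n) \<longlonglongrightarrow> exp (-c)"
    by real_asymp
  show "(\<lambda>n. real n * ?x n powr (?l n + 2)) \<longlonglongrightarrow> exp (-c)"
    by real_asymp
qed

text \<open>This is the limit of the union bound over the \<open>n - 1\<close> vertices other than
  the one covered last.\<close>

lemma uncovered_prob_limit:
  assumes "coupon_window c f"
  shows "(\<lambda>n. (real n - 1) * (1 - 2 / (real n - 1)) ^ f n) \<longlonglongrightarrow> exp (-c)"
proof (rule tendsto_sandwich)
  let ?l = "\<lambda>n. real n / 2 * (ln (real n) + c)" and ?x = "\<lambda>n. 1 - 2 / (real n - 1)"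
  have *: "\<forall>\<^sub>F n in sequentially.
      (real n - 1) * ?x n ^ f n \<le> (real n - 1) * ?x n powr ?l n \<and>
      (real n - 1) * ?x n powr (?l n + 2) \<le> (real n - 1) * ?x n ^ f n"
    using assms[unfolded coupon_window_def] eventually_gt_at_top[of 3]
  proof eventually_elim
    case (elim n)
    then have "?x n ^ f n \<le> ?x n powr ?l n" "?x n powr (?l n + 2) \<le> ?x n ^ f n"
      by (intro powr_window[of _ "?l n" _ "?l n + 2"]; simp add: field_simps)+
    then show ?case
      using elim by (intro conjI mult_left_mono) auto
  qed
  from * show "\<forall>\<^sub>F n in sequentially. (real n - 1) * ?x n ^ f n \<le> (real n - 1) * ?x n powr ?l n"
    by eventually_elim simp
  from * show "\<forall>\<^sub>F n in sequentially. (real n - 1) * ?x n powr (?l n + 2) \<le> (real n - 1) * ?x n ^ f n"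
    by eventually_elim simp
  show "(\<lambda>n. (real n - 1) * ?x n powr ?l n) \<longlonglongrightarrow> exp (-c)"
    by real_asymp
  show "(\<lambda>n. (real n - 1) * ?x n powr (?l n + 2)) \<longlonglongrightarrow> exp (-c)"
    by real_asymp
qed

text \<open>The bound of \<open>prob_uncovered_gt_le\<close> is at most the exponential of a
  multiple of \<open>n\<close> that is eventually negative, provided \<open>z > 1\<close> is close
  enough to 1.\<close>

lemma prob_late_limit:
  fixes s \<alpha> :: real
  assumes "s > 1" "\<alpha> > s\<^sup>2 - s"
  shows "(\<lambda>n. measure_pmf.prob (edge_process n)
    {es. real n / s < real (card (uncovered (real n / s) {1..n} (take (nat \<lceil>\<alpha> * n / 2\<rceil>) es)))})
    \<longlonglongrightarrow> 0"
proof -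
  have ss: "s\<^sup>2 - s > 0"
    using assms(1) by (simp add: power2_eq_square)
  \<comment> \<open>The limit of the rate, \<open>1 - 1 / s - \<alpha> / (z * s\<^sup>2)\<close>, is
    negative iff \<open>z < y\<close>. The assumption on \<alpha> says \<open>y > 1\<close>, and
    \<open>z\<close> is the midpoint between 1 and \<open>y\<close>.\<close>
  define y where "y = \<alpha> / (s\<^sup>2 - s)"
  define z where "z = (1 + y) / 2"
  have "y > 1"
    using ss assms(2) by (simp add: y_def field_simps)
  then have z: "1 < z" "z < y"
    by (auto simp: z_def)
  have \<alpha>: "\<alpha> > 0" using ss assms(2) by linarith
  \<comment> \<open>The largest \<open>p\<close> that \<open>prob_uncovered_gt_le\<close> permits
    for the threshold \<open>n / s\<close>; it tends to \<open>1 / s\<^sup>2\<close>.\<close>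
  define p where "p = (\<lambda>n::nat. (real n / s * (real n / s - 1)) / (real n * (real n - 1)))"
  let ?T = "\<lambda>n::nat. nat \<lceil>\<alpha> * n / 2\<rceil>"
  have "p \<longlonglongrightarrow> inverse s * inverse s"
    unfolding p_def using assms(1) by real_asymp
  then have "(\<lambda>n. (1 - 1 / s) - p n * (\<alpha> / z)) \<longlonglongrightarrow> (1 - 1 / s) - inverse s * inverse s * (\<alpha> / z)"
    by (intro tendsto_intros)
  moreover have "(1 - 1 / s) - inverse s * inverse s * (\<alpha> / z) < 0"
  proof -
    have "z * (s\<^sup>2 - s) < \<alpha>"
      using z(2) ss by (simp add: y_def field_simps)
    then have "(s\<^sup>2 - s) < \<alpha> / z"
      using z(1) by (simp add: field_simps)
    then have "(s\<^sup>2 - s) / s\<^sup>2 < \<alpha> / z / s\<^sup>2"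
      using assms(1) by (intro divide_strict_right_mono) auto
    moreover have "(s\<^sup>2 - s) / s\<^sup>2 = 1 - 1 / s"
      using assms(1) by (simp add: field_simps power2_eq_square)
    ultimately show ?thesis
      by (simp add: power2_eq_square field_simps)
  qed
  moreover have "filterlim (\<lambda>n::nat. (z - 1) / 2 * real n) at_top sequentially"
    using z by real_asymp
  ultimately have "filterlim (\<lambda>n. ((1 - 1 / s) - p n * (\<alpha> / z)) * ((z - 1) / 2 * real n)) at_bot sequentially"
    by (rule filterlim_tendsto_neg_mult_at_bot)
  then have lim: "(\<lambda>n. exp (((1 - 1 / s) - p n * (\<alpha> / z)) * ((z - 1) / 2 * real n))) \<longlonglongrightarrow> 0"
    by (rule filterlim_compose[OF exp_at_bot])
  have bound: "\<forall>\<^sub>F n in sequentially. measure_pmf.prob (edge_process n)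
      {es. real n / s < real (card (uncovered (real n / s) {1..n} (take (?T n) es)))}
    \<le> exp (((1 - 1 / s) - p n * (\<alpha> / z)) * ((z - 1) / 2 * real n))"
    using eventually_gt_at_top[of "nat \<lceil>s\<rceil>"]
  proof eventually_elim
    case (elim n)
    then have ns: "real n > s"
      by linarith
    define \<theta> where "\<theta> = real n / s"
    have \<theta>: "1 < \<theta>" "\<theta> \<le> real n"
      using ns assms(1) by (auto simp: \<theta>_def field_simps)
    have pn: "p n = \<theta> * (\<theta> - 1) / (real n * (real n - 1))"
      by (simp add: p_def \<theta>_def)
    have n1: "real n * (real n - 1) > 0"
      using ns assms(1) by (intro mult_pos_pos) auto
    have p0: "0 < p n"
      unfolding pn using \<theta> n1 by (intro divide_pos_pos mult_pos_pos) auto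
    have "\<theta> * (\<theta> - 1) \<le> real n * (real n - 1)"
      using \<theta> by (intro mult_mono) auto
    then have p1: "p n \<le> 1"
      unfolding pn using n1 by (simp add: divide_le_eq_1)
    have "measure_pmf.prob (edge_process n) {es. \<theta> < real (card (uncovered \<theta> {1..n} (take (?T n) es)))}
        \<le> z powr ((card {1..n} - \<theta>) / 2) * (1 - p n * (1 - 1 / z)) ^ ?T n"
      unfolding edge_process_def
    proof (rule prob_uncovered_gt_le)
      show "p n * real (card (complete_edges n)) \<le> \<theta> * (\<theta> - 1) / 2"
        unfolding card_complete_edges real_choose_two pn using n1 by (auto simp: zero_less_mult_iff)
    qed (use \<theta> z p0 p1 in \<open>auto simp: complete_edges_def\<close>)
    \<comment> \<open>The two factors are estimated by \<open>ln z \<le> z - 1\<close> and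
      \<open>1 - x \<le> exp (- x)\<close>. Since \<open>1 - 1 / z = (z - 1) / z\<close>, a common
      factor \<open>z - 1\<close> comes out of the exponent.\<close>
    also have "\<dots> \<le> exp ((z - 1) * ((real n - \<theta>) / 2)) * exp (- (p n * (1 - 1 / z)) * (\<alpha> * n / 2))"
    proof (rule mult_mono)
      have "ln z * ((real n - \<theta>) / 2) \<le> (z - 1) * ((real n - \<theta>) / 2)"
        using z \<theta> ln_le_minus_one[of z] by (intro mult_right_mono) auto
      then show "z powr ((card {1..n} - \<theta>) / 2) \<le> exp ((z - 1) * ((real n - \<theta>) / 2))"
        using z by (simp add: powr_def mult.commute)
      have "p n * (1 - 1 / z) \<le> 1 * 1"
        using z p0 p1 by (intro mult_mono) auto
      then have r0: "0 \<le> 1 - p n * (1 - 1 / z)"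
        by simp
      then show "0 \<le> (1 - p n * (1 - 1 / z)) ^ ?T n"
        by simp
      have "(1 - p n * (1 - 1 / z)) ^ ?T n \<le> exp (- (p n * (1 - 1 / z))) ^ ?T n"
        using r0 exp_ge_add_one_self[of "- (p n * (1 - 1 / z))"] by (intro power_mono) auto
      also have "\<dots> = exp (- (p n * (1 - 1 / z)) * real (?T n))"
        by (simp add: exp_of_nat_mult[symmetric] mult.commute)
      also have "\<dots> \<le> exp (- (p n * (1 - 1 / z)) * (\<alpha> * n / 2))"
      proof -
        have "\<alpha> * n / 2 \<le> real (?T n)"
          by linarith
        moreover have "0 \<le> p n * (1 - 1 / z)"
          using p0 z by simp
        ultimately have "p n * (1 - 1 / z) * (\<alpha> * n / 2) \<le> p n * (1 - 1 / z) * real (?T n)"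
          by (rule mult_left_mono)
        then show ?thesis
          by (simp only: exp_le_cancel_iff mult_minus_left neg_le_iff_le)
      qed
      finally show "(1 - p n * (1 - 1 / z)) ^ ?T n \<le> exp (- (p n * (1 - 1 / z)) * (\<alpha> * n / 2))" .
    qed simp
    also have "\<dots> = exp (((1 - 1 / s) - p n * (\<alpha> / z)) * ((z - 1) / 2 * real n))"
      using z assms(1) unfolding exp_add[symmetric] \<theta>_def by (simp add: field_simps)
    finally show ?case
      by (simp add: \<theta>_def)
  qed
  show ?thesis
    by (rule tendsto_sandwich[OF _ bound tendsto_const lim]) simp
qed

text \<open>At the level \<open>i \<le> 10\<close> the expected number of vertices that have not been covered since time
  \<open>T\<close> tends to \<open>exp (- level i) = (11 - i) / 12\<close>.\<close>

definition level :: "nat \<Rightarrow> real" where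
  "level i = - ln ((11 - real (min i 10)) / 12)"

lemma exp_level: "exp (- level i) = (11 - real (min i 10)) / 12"
  by (simp add: level_def)

lemma level_nonneg: "0 \<le> level i"
  by (simp add: level_def)

text \<open>The cap \<open>min i 10\<close> keeps the argument of the logarithm at 1/12 or more, so
  monotonicity holds for all indices, as \<open>prob_last_isolated_ge\<close> requires.\<close>

lemma mono_level: "mono level"
  unfolding level_def by (intro monoI) (auto simp: min_def)

text \<open>\<open>L\<close> is the lower bound of \<open>prob_last_isolated_ge\<close> with 10
  levels. Up to the factor \<open>exp (- \<alpha>)\<close>, its limit is a lower Riemann sum for the
  integral of \<open>1 - x\<close> over the unit interval.\<close>

lemma prob_last_isolated_limit:
  fixes \<alpha> :: real
  assumes "\<alpha> > 0"
  obtains L where "L \<longlonglongrightarrow> 55 / 144 * exp (- \<alpha>)"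
    "\<forall>\<^sub>F n in sequentially. L n \<le>
       measure_pmf.prob (edge_process n) {es. last_isolated n (nat \<lceil>\<alpha> * n / 2\<rceil>) es}"
proof -
  let ?T = "\<lambda>n::nat. nat \<lceil>\<alpha> * n / 2\<rceil>"
  let ?m = "\<lambda>n i. nat \<lceil>real n / 2 * (ln (real n) + level i)\<rceil>"
  have win_m: "coupon_window (level i) (\<lambda>n. ?m n i)" for i
    unfolding coupon_window_def using eventually_ge_at_top[of 1]
  proof eventually_elim
    case (elim n)
    then have "0 \<le> real n / 2 * (ln (real n) + level i)"
      using level_nonneg[of i] by (intro mult_nonneg_nonneg add_nonneg_nonneg) auto
    then show ?case by linarith
  qed
  have win_a: "coupon_window (\<alpha> + level i) (\<lambda>n. ?T n + ?m n i)" for i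
    unfolding coupon_window_def using eventually_ge_at_top[of 1]
  proof eventually_elim
    case (elim n)
    then have "0 \<le> real n / 2 * (ln (real n) + level i)"
      using level_nonneg[of i] by (intro mult_nonneg_nonneg add_nonneg_nonneg) auto
    moreover have "0 \<le> \<alpha> * real n / 2"
      using assms by simp
    moreover have "real n / 2 * (ln (real n) + (\<alpha> + level i)) =
        \<alpha> * real n / 2 + real n / 2 * (ln (real n) + level i)"
      by (simp add: algebra_simps)
    ultimately show ?case by linarith
  qed
  define L where "L = (\<lambda>n. \<Sum>i<10.
      (real n * isolated_prob n (?T n + ?m n i) - real n * isolated_prob n (?T n + ?m n (Suc i))) *
      (1 - (real n - 1) * (1 - 2 / (real n - 1)) ^ ?m n i))"
  have "L \<longlonglongrightarrow> (\<Sum>i<10. (exp (- (\<alpha> + level i)) - exp (- (\<alpha> + level (Suc i)))) * (1 - exp (- level i)))"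
    unfolding L_def
    by (intro tendsto_sum tendsto_mult tendsto_diff tendsto_const
        isolated_prob_limit uncovered_prob_limit win_m win_a)
  also have "(\<Sum>i<10. (exp (- (\<alpha> + level i)) - exp (- (\<alpha> + level (Suc i)))) * (1 - exp (- level i))) =
      (\<Sum>i<10. exp (- \<alpha>) * (real (Suc i) / 144))"
  \<comment> \<open>Neighbouring levels differ by 1/12 after exponentiation, and all other vertices
    are covered with weight \<open>(i + 1) / 12\<close>. The sum of 1 to 10 then gives 55.\<close>
  proof (rule sum.cong)
    fix i :: nat assume "i \<in> {..<10}"
    then have eq: "exp (- level i) = (11 - real i) / 12" "exp (- level (Suc i)) = (10 - real i) / 12"
      by (auto simp: exp_level min_def)
    then show "(exp (- (\<alpha> + level i)) - exp (- (\<alpha> + level (Suc i)))) * (1 - exp (- level i)) =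
        exp (- \<alpha>) * (real (Suc i) / 144)"
      unfolding minus_add_distrib exp_add eq by (simp add: field_simps)
  qed simp
  also have "\<dots> = 55 / 144 * exp (- \<alpha>)"
    by (simp add: eval_nat_numeral)
  finally have 1: "L \<longlonglongrightarrow> 55 / 144 * exp (- \<alpha>)" .
  have "\<forall>\<^sub>F n in sequentially. L n \<le>
       measure_pmf.prob (edge_process n) {es. last_isolated n (?T n) es}"
    using coupon_window_small[OF win_a[of 10]] eventually_ge_at_top[of 3]
  proof eventually_elim
    case (elim n)
    have "mono (?m n)"
      using mono_level by (intro monoI nat_mono ceiling_mono mult_left_mono add_left_mono) (auto dest: monoD)
    then have "real n * (\<Sum>i<10. (isolated_prob n (?T n + ?m n i) - isolated_prob n (?T n + ?m n (Suc i))) *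
        (1 - (real n - 1) * (1 - 2 / (real n - 1)) ^ ?m n i))
      \<le> measure_pmf.prob (edge_process n) {es. last_isolated n (?T n) es}"
      using elim by (intro prob_last_isolated_ge) auto
    moreover have "x * ((a - b) * q) = (x * a - x * b) * q" for x a b q :: real
      by (simp add: algebra_simps)
    ultimately show ?case
      by (simp only: L_def sum_distrib_left)
  qed
  with 1 show ?thesis by (rule that)
qed

section \<open>The numerical comparison and the conclusion\<close>

lemma exp_ge_multiple:
  fixes s :: real
  assumes "s \<ge> 1"
  shows "8 / 3 * s \<le> exp s"
proof -
  \<comment> \<open>The value is \<open>(25 / 18) ^ 3\<close>, about 2.679. The quadratic Taylor
    bound taken directly at 1 gives only 5/2, too small for the comparison with 55/144.\<close>
  have "(8::real) / 3 \<le> (1 + 1 / 3 + (1 / 3)\<^sup>2 / 2) ^ 3"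
    by (simp add: power2_eq_square power3_eq_cube)
  also have "\<dots> \<le> exp (1 / 3) ^ 3"
    by (intro power_mono exp_lower_Taylor_quadratic) auto
  also have "\<dots> = exp 1"
    by (simp flip: exp_of_nat_mult)
  finally have "8 / 3 * s \<le> exp 1 * exp (s - 1)"
    using exp_ge_add_one_self[of "s - 1"] assms by (intro mult_mono) auto
  then show ?thesis
    by (simp flip: exp_add)
qed

text \<open>The limit of the lower bound strictly exceeds the target, so no error term remains for
  large \<open>n\<close>.\<close>

lemma eventually_prob_success_ge:
  fixes s :: real
  assumes "s > 0"
  shows "\<forall>\<^sub>F n in sequentially. s / exp (s\<^sup>2) \<le>
    measure_pmf.prob (builder_graph n (tau 1 n) (cover_strategy (real n / s) n)) {B. min_degree n B \<ge> 1}"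
proof (cases "s > 1")
  case False
  \<comment> \<open>For \<open>s \<le> 1\<close> the threshold is at least \<open>n\<close> and
    success is certain; the target only has to be at most 1.\<close>
  have "s \<le> exp (s\<^sup>2)"
    using False exp_ge_add_one_self[of "s\<^sup>2"] by (smt (verit) zero_le_power2)
  then have le: "s / exp (s\<^sup>2) \<le> 1"
    by (simp add: divide_le_eq_1)
  show ?thesis
    using eventually_ge_at_top[of 2]
  proof eventually_elim
    case (elim n)
    have "real n \<le> real n / s"
      using False assms by (simp add: pos_le_divide_eq mult_left_le)
    from prob_success_large_threshold[OF elim this] le show ?case
      by (simp only:)
  qed
next
  case True
  \<comment> \<open>\<open>prob_late_limit\<close> needs a strict inequality. The excess 1/100 costs
    a factor of at least 99/100, which is affordable because
    \<open>55 / 144 * (8 / 3) * (99 / 100) > 1\<close>.\<close>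
  define \<alpha> where "\<alpha> = s\<^sup>2 - s + 1 / 100"
  have \<alpha>: "\<alpha> > s\<^sup>2 - s" "\<alpha> > 0"
    using True by (auto simp: \<alpha>_def power2_eq_square add_pos_pos)
  let ?T = "\<lambda>n::nat. nat \<lceil>\<alpha> * n / 2\<rceil>"
  let ?F = "\<lambda>n. measure_pmf.prob (edge_process n)
    {es. real n / s < real (card (uncovered (real n / s) {1..n} (take (?T n) es)))}"
  obtain L where L: "L \<longlonglongrightarrow> 55 / 144 * exp (- \<alpha>)"
    "\<forall>\<^sub>F n in sequentially. L n \<le> measure_pmf.prob (edge_process n) {es. last_isolated n (?T n) es}"
    using prob_last_isolated_limit[OF \<alpha>(2)] by blast
  have "s < 55 / 144 * (8 / 3 * s * (1 + - 1 / 100))"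
    using True by simp
  also have "\<dots> \<le> 55 / 144 * (exp s * exp (- 1 / 100))"
    using exp_ge_multiple[of s] exp_ge_add_one_self[of "- 1 / 100"] True
    by (intro mult_left_mono mult_mono) auto
  finally have "s * exp (- s\<^sup>2) < 55 / 144 * (exp s * exp (- 1 / 100)) * exp (- s\<^sup>2)"
    by (intro mult_strict_right_mono) auto
  also have "\<dots> = 55 / 144 * exp (- \<alpha>)"
    by (simp add: \<alpha>_def mult.assoc flip: exp_add)
  finally have "s * exp (- s\<^sup>2) < 55 / 144 * exp (- \<alpha>)" .
  moreover have "s / exp (s\<^sup>2) = s * exp (- s\<^sup>2)"
    by (simp only: divide_inverse exp_minus)
  ultimately have "s / exp (s\<^sup>2) < 55 / 144 * exp (- \<alpha>) - 0"
    by (simp only: diff_zero)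
  then have "\<forall>\<^sub>F n in sequentially. s / exp (s\<^sup>2) < L n - ?F n"
    by (intro order_tendstoD(1)[OF tendsto_diff[OF L(1) prob_late_limit[OF True \<alpha>(1)]]])
  then show ?thesis
    using L(2) eventually_ge_at_top[of 2]
  proof eventually_elim
    case (elim n)
    then show ?case
      using prob_success_ge[of n "?T n" "real n / s"] by linarith
  qed
qed

theorem theorem1p2:
  fixes C :: real
  assumes "C > 0"
  shows "\<exists>\<epsilon> :: nat \<Rightarrow> real. \<epsilon> \<longlonglongrightarrow> 0 \<and>
    (\<forall>n \<ge> 2. \<exists>S. is_strategy n (tau 1 n) ((1/2 + C powr (-1/2) / 2) * real n) S \<and>
       measure_pmf.prob (builder_graph n (tau 1 n) S) {B. min_degree n B \<ge> 1}
         \<ge> (1 - \<epsilon> n) * (sqrt C / exp C))"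
proof -
  let ?S = "\<lambda>n. cover_strategy (real n / sqrt C) n"
  let ?P = "\<lambda>n. measure_pmf.prob (builder_graph n (tau 1 n) (?S n)) {B. min_degree n B \<ge> 1}"
  \<comment> \<open>The value 1 makes the claim trivial for the finitely many \<open>n\<close> where
    the bound may fail; from some point on the error is 0.\<close>
  define \<epsilon> where "\<epsilon> = (\<lambda>n. if sqrt C / exp C \<le> ?P n then 0 else (1::real))"
  have "\<forall>\<^sub>F n in sequentially. sqrt C / exp C \<le> ?P n"
    using eventually_prob_success_ge[of "sqrt C"] assms by simp
  then have "\<forall>\<^sub>F n in sequentially. \<epsilon> n = 0"
    by eventually_elim (simp add: \<epsilon>_def)
  then have "\<epsilon> \<longlonglongrightarrow> 0"
    by (rule tendsto_eventually)
  moreover have "is_strategy n (tau 1 n) ((1/2 + C powr (-1/2) / 2) * real n) (?S n)" for n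
  proof -
    have "C powr (-1/2) = 1 / sqrt C"
      using assms by (simp add: powr_minus_divide powr_half_sqrt)
    then have "(1/2 + C powr (-1/2) / 2) * real n = (real n + real n / sqrt C) / 2"
      by (simp add: distrib_right add_divide_distrib)
    moreover have "0 \<le> real n / sqrt C"
      using assms by simp
    ultimately show ?thesis
      by (simp only: is_strategy_cover_strategy)
  qed
  moreover have "(1 - \<epsilon> n) * (sqrt C / exp C) \<le> ?P n" for n
    by (simp add: \<epsilon>_def)
  ultimately show ?thesis
    by blast
qed

end
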